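(* Let $p$ and $q$ be nonzero integers with $q \neq 1$ and $p - q = 1$. Let $(U_n)_{n\ge 0}$ be defined by $U_0 = 0$, $U_1 = 1$, and $U_n = pU_{n-1} - qU_{n-2}$ for $n \ge 2$. Then for all $n \geq 1$, $$\sum_{i=1}^n i\, U_i = \frac{q}{q-1} \left( n U_n - \frac{q U_{n-1} - n + 1}{q-1} - \frac{1}{q} \binom{n+1}{2} \right).$$
   Context: $(U_n)$ is the Lucas sequence of the first kind with parameters $p,q$. *)

theory Defs
  imports Complex_Main
begin

fun lucas_U :: "int \<Rightarrow> int \<Rightarrow> nat \<Rightarrow> int" where
  "lucas_U p q 0 = 0"
| "lucas_U p q (Suc 0) = 1"
| "lucas_U p q (Suc (Suc n)) = p * lucas_U p q (Suc n) - q * lucas_U p q n"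

end

theory Submission
  imports Defs
begin

text \<open>When \<open>p = q + 1\<close>, the characteristic polynomial has the root \<open>1\<close>, and the second-order
  recurrence collapses to \<open>U\<^sub>n\<^sub>+\<^sub>1 = q U\<^sub>n + 1\<close>. Cleared of denominators, the
  summation formula then follows by induction on \<open>n\<close>.\<close>

text \<open>For \<open>p = q + 1\<close> the recurrence reads U(n+2) - q U(n+1) = U(n+1) - q U(n),
  so this difference is constant and keeps its initial value 1.\<close>

lemma lucas_U_Suc:
  assumes "p - q = 1"
  shows "lucas_U p q (Suc n) = q * lucas_U p q n + 1"
proof (induction n)
  case (Suc n)
  have "p = q + 1"
    using assms by simp
  then show ?case
    using Suc by (simp add: algebra_simps)
qed simp

text \<open>Multiplying the target formula by (q - 1)^2 keeps the induction within the integers;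
  indexing by n = m + 1 avoids truncated subtraction.\<close>

lemma sum_index_lucas_U:
  fixes p q :: int
  assumes "p - q = 1"
  shows "(q - 1)\<^sup>2 * (\<Sum>i = 1..Suc m. int i * lucas_U p q i) =
    q * (q - 1) * int (Suc m) * lucas_U p q (Suc m) - q * (q * lucas_U p q m - int m)
      - (q - 1) * int (Suc (Suc m) choose 2)"
proof (induction m)
  case 0
  show ?case
    by (simp add: numeral_2_eq_2 algebra_simps)
next
  case (Suc m)
  have choose: "Suc (Suc (Suc m)) choose 2 = Suc (Suc m) + (Suc (Suc m) choose 2)"
    by (simp add: numeral_2_eq_2)
  have "(q - 1)\<^sup>2 * (\<Sum>i = 1..Suc (Suc m). int i * lucas_U p q i) =
      (q - 1)\<^sup>2 * (\<Sum>i = 1..Suc m. int i * lucas_U p q i)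
        + (q - 1)\<^sup>2 * (int (Suc (Suc m)) * lucas_U p q (Suc (Suc m)))"
    by (simp add: algebra_simps)
  \<comment> \<open>Pascal's rule leaves one binomial and \<open>lucas_U_Suc\<close> reduces the
    Lucas terms outside the sum to U(m), so a polynomial identity remains.\<close>
  then show ?case
    unfolding Suc choose lucas_U_Suc[OF assms] of_nat_add
    by (simp add: power2_eq_square algebra_simps)
qed

theorem theorem4p3:
  fixes p q :: int and n :: nat
  assumes "p \<noteq> 0" and "q \<noteq> 0" and "q \<noteq> 1" and "p - q = 1" and "n \<ge> 1"
  shows "(\<Sum>i = 1..n. of_nat i * of_int (lucas_U p q i) :: rat) =
    of_int q / (of_int q - 1) *
      (of_nat n * of_int (lucas_U p q n)
       - (of_int q * of_int (lucas_U p q (n - 1)) - of_nat n + 1) / (of_int q - 1)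
       - 1 / of_int q * of_nat ((n + 1) choose 2))"
proof -
  obtain m where n: "n = Suc m"
    using \<open>n \<ge> 1\<close> by (cases n) auto
  define Q :: rat where "Q = of_int q"
  define u :: rat where "u = of_int (lucas_U p q m)"
  define v :: rat where "v = of_int (lucas_U p q n)"
  define c :: rat where "c = of_nat ((n + 1) choose 2)"
  define S :: rat where "S = (\<Sum>i = 1..n. of_nat i * of_int (lucas_U p q i))"
  \<comment> \<open>The first fact handles the term 1/Q; the second allows (Q - 1)^2 to be cancelled
    at the end.\<close>
  have Q: "Q \<noteq> 0" "Q - 1 \<noteq> 0"
    using assms by (simp_all add: Q_def)
  have "(Q - 1)\<^sup>2 * S = Q * (Q - 1) * of_nat n * v - Q * (Q * u - of_nat m) - (Q - 1) * c"
    using arg_cong[OF sum_index_lucas_U[OF \<open>p - q = 1\<close>, of m], of "of_int :: int \<Rightarrow> rat"]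
    by (simp only: Q_def u_def v_def c_def S_def n of_int_sum of_int_mult of_int_diff
        of_int_power of_int_of_nat_eq of_int_1 Suc_eq_plus1)
  \<comment> \<open>The numerators agree because n = m + 1 gives Q u - n + 1 = Q u - m.\<close>
  also have "\<dots> = (Q - 1)\<^sup>2 *
      (Q / (Q - 1) * (of_nat n * v - (Q * u - of_nat n + 1) / (Q - 1) - 1 / Q * c))"
    using Q by (simp add: n divide_simps power2_eq_square) (simp add: algebra_simps)
  finally have "S = Q / (Q - 1) * (of_nat n * v - (Q * u - of_nat n + 1) / (Q - 1) - 1 / Q * c)"
    using Q by (simp only: mult_cancel_left power_eq_0_iff) simp
  then show ?thesis
    by (simp add: Q_def u_def v_def c_def S_def n)
qed

end
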